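(* Let $G=(V,E)$ be a locally finite simple graph, $x\in V$ and $\mathcal N\in(0,\infty]$. If $x$ is $\mathcal N$-curvature sharp, then $x$ is $\mathcal N'$-curvature sharp for any $\mathcal N'\in(0,\mathcal N]$.
   Context: Graphs are undirected, without loops or multiple edges, and every vertex has finite degree; $d_x$ is the degree of $x$, and the vertex $x$ considered has $d_x\ge1$. For $f:V\to\mathbb R$ put $\Delta f(x)=\sum_{y\sim x}(f(y)-f(x))$ (non-normalized Laplacian), and for $f,g:V\to\mathbb R$ put $2\Gamma(f,g)=\Delta(fg)-f\Delta g-g\Delta f$, $2\Gamma_2(f,g)=\Delta\Gamma(f,g)-\Gamma(f,\Delta g)-\Gamma(\Delta f,g)$, $\Gamma(f)=\Gamma(f,f)$, $\Gamma_2(f)=\Gamma_2(f,f)$. For $\mathcal N\in(0,\infty]$ (convention $1/\infty=0$), $\mathcal K_{G,x}(\mathcal N)$ is the largest $K\in\mathbb R$ such that $\Gamma_2(f)(x)\ge\frac1{\mathcal N}(\Delta f(x))^2+K\,\Gamma(f)(x)$ for all $f:V\to\mathbb R$ (Bakry-Émery curvature function). $S_1(x)$ is the set of neighbours of $x$. For $y\in S_1(x)$, the out degree $d_y^+$ is the number of neighbours of $y$ at graph distance $2$ from $x$; $av_1^+(x)=\frac1{d_x}\sum_{y\in S_1(x)}d_y^+$; and $\mathcal K_\infty^0(x)=\frac{3+d_x-av_1^+(x)}2$. The vertex $x$ is $\mathcal N$-curvature sharp if $\mathcal K_{G,x}(\mathcal N)=\mathcal K_\infty^0(x)-\frac{2d_x}{\mathcal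 N}$. *)

theory Defs
  imports Complex_Main "HOL-Library.Extended_Real"
begin

text \<open>Bakry-Emery curvature of locally finite simple graphs for the non-normalized Laplacian.
  A graph has a vertex set and a set of edges, each edge being an unordered pair of distinct
  vertices.\<close>

definition nbrs :: "'a set set \<Rightarrow> 'a \<Rightarrow> 'a set" where
  "nbrs E x = {y. {x, y} \<in> E}"

definition deg :: "'a set set \<Rightarrow> 'a \<Rightarrow> nat" where
  "deg E x = card (nbrs E x)"

locale locally_finite_graph =
  fixes V :: "'a set" and E :: "'a set set"
  assumes edges: "\<And>e. e \<in> E \<Longrightarrow> \<exists>u\<in>V. \<exists>v\<in>V. u \<noteq> v \<and> e = {u, v}"
    and finite_nbrs: "\<And>x. x \<in> V \<Longrightarrow> finite (nbrs E x)"

text \<open>Graph distance, infinite between different connected components. The relational power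
  states the existence of a walk of length \<open>n\<close> from \<open>x\<close> to \<open>y\<close>.\<close>

definition graph_dist :: "'a set set \<Rightarrow> 'a \<Rightarrow> 'a \<Rightarrow> enat" where
  "graph_dist E x y = (INF n \<in> {n. ((\<lambda>u v. v \<in> nbrs E u) ^^ n) x y}. enat n)"

text \<open>Functions on the vertex set are total functions on the ambient type. All operators below,
  evaluated at a vertex, depend only on the values on the vertex set, since neighbours of vertices
  are vertices.\<close>

definition laplacian :: "'a set set \<Rightarrow> ('a \<Rightarrow> real) \<Rightarrow> 'a \<Rightarrow> real" where
  "laplacian E f x = (\<Sum>y\<in>nbrs E x. f y - f x)"

definition carre_du_champ :: "'a set set \<Rightarrow> ('a \<Rightarrow> real) \<Rightarrow> ('a \<Rightarrow> real) \<Rightarrow> 'a \<Rightarrow> real" where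
  "carre_du_champ E f g x =
    (laplacian E (\<lambda>y. f y * g y) x - f x * laplacian E g x - g x * laplacian E f x) / 2"

definition carre_du_champ2 :: "'a set set \<Rightarrow> ('a \<Rightarrow> real) \<Rightarrow> ('a \<Rightarrow> real) \<Rightarrow> 'a \<Rightarrow> real" where
  "carre_du_champ2 E f g x =
    (laplacian E (carre_du_champ E f g) x
      - carre_du_champ E f (laplacian E g) x
      - carre_du_champ E (laplacian E f) g x) / 2"

text \<open>The dimension parameter ranges over \<open>(0, \<infinity>]\<close>, and \<open>1 / \<infinity> = 0\<close> in the extended reals, so
  \<open>real_of_ereal (1 / N)\<close> is the real number \<open>1 / N\<close> with the usual convention.\<close>

definition curvature_dimension :: "'a set set \<Rightarrow> 'a \<Rightarrow> ereal \<Rightarrow> real \<Rightarrow> bool" where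
  "curvature_dimension E x N K \<longleftrightarrow>
    (\<forall>f :: 'a \<Rightarrow> real.
      carre_du_champ2 E f f x
        \<ge> real_of_ereal (1 / N) * (laplacian E f x)\<^sup>2 + K * carre_du_champ E f f x)"

text \<open>The largest \<open>K\<close> exists at every vertex of positive degree of a locally finite graph. At an
  isolated vertex every \<open>K\<close> is admissible and the value is unspecified.\<close>

definition curvature :: "'a set set \<Rightarrow> 'a \<Rightarrow> ereal \<Rightarrow> real" where
  "curvature E x N = (GREATEST K. curvature_dimension E x N K)"

definition out_deg :: "'a set set \<Rightarrow> 'a \<Rightarrow> 'a \<Rightarrow> nat" where
  "out_deg E x y = card {z \<in> nbrs E y. graph_dist E x z = 2}"

definition av_out_deg :: "'a set set \<Rightarrow> 'a \<Rightarrow> real" where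
  "av_out_deg E x = (\<Sum>y\<in>nbrs E x. real (out_deg E x y)) / real (deg E x)"

definition curvature_bound0 :: "'a set set \<Rightarrow> 'a \<Rightarrow> real" where
  "curvature_bound0 E x = (3 + real (deg E x) - av_out_deg E x) / 2"

definition curvature_sharp :: "'a set set \<Rightarrow> 'a \<Rightarrow> ereal \<Rightarrow> bool" where
  "curvature_sharp E x N \<longleftrightarrow>
    curvature E x N = curvature_bound0 E x - 2 * real (deg E x) * real_of_ereal (1 / N)"

end

theory Submission
  imports Defs "HOL-Analysis.Analysis"
begin

text \<open>For \<open>f\<close> equal to the distance from \<open>x\<close> truncated at \<open>2\<close>, the curvature-dimension inequality
  reads \<open>K \<le> curvature_bound0 E x - 2 * deg E x / N\<close>, so sharpness means that this bound itself is an
  admissible \<open>K\<close>. By Cauchy-Schwarz \<open>(laplacian E f x)\<^sup>2 \<le> 2 * deg E x * carre_du_champ E f f x\<close>;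
  hence the right-hand side of the inequality with \<open>K = curvature_bound0 E x - 2 * deg E x / N\<close> only
  decreases as \<open>N\<close> decreases.\<close>

lemma carre_du_champ_eq:
  "carre_du_champ E f g x = (\<Sum>y\<in>nbrs E x. (f y - f x) * (g y - g x)) / 2"
proof -
  have "laplacian E (\<lambda>y. f y * g y) x - f x * laplacian E g x - g x * laplacian E f x
      = (\<Sum>y\<in>nbrs E x. (f y * g y - f x * g x) - f x * (g y - g x) - g x * (f y - f x))"
    by (simp only: laplacian_def sum_subtractf[symmetric] sum_distrib_left)
  also have "\<dots> = (\<Sum>y\<in>nbrs E x. (f y - f x) * (g y - g x))"
    by (intro sum.cong) (simp_all add: algebra_simps)
  finally show ?thesis
    by (simp add: carre_du_champ_def)
qed

lemma carre_du_champ_diag: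
  "carre_du_champ E f f x = (\<Sum>y\<in>nbrs E x. (f y - f x)\<^sup>2) / 2"
  by (simp add: carre_du_champ_eq power2_eq_square)

lemma laplacian_sq_le:
  "(laplacian E f x)\<^sup>2 \<le> 2 * real (deg E x) * carre_du_champ E f f x"
  \<comment> \<open>Without finiteness, sums over the neighbours and \<open>deg\<close> default to 0
    and both sides vanish.\<close>
  using sum_squared_le_sum_of_squares[of "\<lambda>y. f y - f x" "nbrs E x"]
  by (cases "finite (nbrs E x)")
     (simp_all add: laplacian_def carre_du_champ_diag deg_def mult.commute)

text \<open>Inserting the sum form of \<open>carre_du_champ\<close> at each neighbour gathers
  everything beyond \<open>x\<close> into one sum over two-step walks x, y, z. This form serves both
  for a lower bound over all \<open>f\<close> and for evaluating a test function.\<close>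

lemma carre_du_champ2_diag:
  "carre_du_champ2 E f f x =
    ((\<Sum>y\<in>nbrs E x. \<Sum>z\<in>nbrs E y. (f z - f y)\<^sup>2 / 2 - (f y - f x) * (f z - f y))
      + (laplacian E f x)\<^sup>2 - real (deg E x) * carre_du_champ E f f x) / 2"
proof -
  have "laplacian E (carre_du_champ E f f) x
      = (\<Sum>y\<in>nbrs E x. \<Sum>z\<in>nbrs E y. (f z - f y)\<^sup>2 / 2) - real (deg E x) * carre_du_champ E f f x"
    unfolding laplacian_def sum_subtractf deg_def
    by (simp add: carre_du_champ_diag sum_divide_distrib)
  moreover have "(\<Sum>y\<in>nbrs E x. (f y - f x) * (laplacian E f y - laplacian E f x))
      = (\<Sum>y\<in>nbrs E x. \<Sum>z\<in>nbrs E y. (f y - f x) * (f z - f y)) - (laplacian E f x)\<^sup>2"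
  proof -
    have "(\<Sum>y\<in>nbrs E x. (f y - f x) * (laplacian E f y - laplacian E f x))
      = (\<Sum>y\<in>nbrs E x. (f y - f x) * laplacian E f y)
        - (\<Sum>y\<in>nbrs E x. (f y - f x)) * laplacian E f x"
      by (simp only: sum_distrib_right sum_subtractf[symmetric] right_diff_distrib[symmetric])
    then show ?thesis
      unfolding laplacian_def by (simp only: power2_eq_square sum_distrib_left)
  qed
  ultimately show ?thesis
    by (simp add: carre_du_champ2_def carre_du_champ_eq[of E f "laplacian E f"]
        carre_du_champ_eq[of E "laplacian E f" f] sum_subtractf mult.commute[of "laplacian E f _ - _"])
qed

lemma curvature_dimension_mono_dim:
  assumes "curvature_dimension E x N (K - 2 * real (deg E x) * real_of_ereal (1 / N))"
    and "real_of_ereal (1 / N) \<le> real_of_ereal (1 / N')"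
  shows "curvature_dimension E x N' (K - 2 * real (deg E x) * real_of_ereal (1 / N'))"
  unfolding curvature_dimension_def
proof
  fix f :: "'a \<Rightarrow> real"
  \<comment> \<open>The right-hand side at dimension \<open>N\<close> is
    \<open>K * carre_du_champ E f f x\<close> minus \<open>real_of_ereal (1 / N) * ?D\<close>, and
    \<open>?D\<close> is nonnegative by Cauchy-Schwarz.\<close>
  let ?D = "2 * real (deg E x) * carre_du_champ E f f x - (laplacian E f x)\<^sup>2"
  have "real_of_ereal (1 / N) * ?D \<le> real_of_ereal (1 / N') * ?D"
    using assms(2) laplacian_sq_le[of E f x] by (intro mult_right_mono) auto
  moreover have "real_of_ereal (1 / N) * (laplacian E f x)\<^sup>2
      + (K - 2 * real (deg E x) * real_of_ereal (1 / N)) * carre_du_champ E f f x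
      \<le> carre_du_champ2 E f f x"
    using assms(1) by (simp add: curvature_dimension_def)
  ultimately show "real_of_ereal (1 / N') * (laplacian E f x)\<^sup>2
      + (K - 2 * real (deg E x) * real_of_ereal (1 / N')) * carre_du_champ E f f x
      \<le> carre_du_champ2 E f f x"
    by (simp add: algebra_simps)
qed

text \<open>For each \<open>f\<close> the condition is a non-strict inequality affine in
  \<open>K\<close>, and an intersection of closed sets is closed. This makes the supremum of the
  admissible \<open>K\<close> admissible.\<close>

lemma closed_curvature_dimension: "closed {K. curvature_dimension E x N K}"
  unfolding curvature_dimension_def
  by (intro closed_Collect_all closed_Collect_le continuous_intros)

lemma graph_dist_le:
  assumes "((\<lambda>u v. v \<in> nbrs E u) ^^ n) x y"
  shows "graph_dist E x y \<le> enat n"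
  unfolding graph_dist_def using assms by (intro INF_lower) simp

text \<open>The walk through \<open>y\<close> bounds the distance by 2, so only lengths 0 and 1 have
  to be excluded. The criterion matches the case distinction in the test function below.\<close>

lemma graph_dist_eq_2_iff:
  assumes "y \<in> nbrs E x" "z \<in> nbrs E y"
  shows "graph_dist E x z = 2 \<longleftrightarrow> z \<noteq> x \<and> z \<notin> nbrs E x"
proof
  assume d: "graph_dist E x z = 2"
  have "z \<noteq> x"
    using graph_dist_le[of 0 E x z] d by (auto simp: zero_enat_def[symmetric])
  moreover have "z \<notin> nbrs E x"
  proof
    assume "z \<in> nbrs E x"
    then have "graph_dist E x z \<le> enat 1"
      by (intro graph_dist_le) auto
    then show False
      using d by (simp add: numeral_eq_enat)
  qed
  ultimately show "z \<noteq> x \<and> z \<notin> nbrs E x" ..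
next
  assume z: "z \<noteq> x \<and> z \<notin> nbrs E x"
  have "graph_dist E x z \<le> enat 2"
    using assms by (intro graph_dist_le) (auto simp: numeral_2_eq_2)
  moreover have "enat 2 \<le> graph_dist E x z"
    unfolding graph_dist_def
  proof (rule INF_greatest)
    fix n assume n: "n \<in> {n. ((\<lambda>u v. v \<in> nbrs E u) ^^ n) x z}"
    have "n \<noteq> 0" using n z by (auto intro: gr0I)
    moreover have "n \<noteq> 1" using n z by (auto simp: relpowp_1)
    ultimately show "enat 2 \<le> enat n" by simp
  qed
  ultimately show "graph_dist E x z = 2"
    by (simp add: numeral_eq_enat)
qed

context locally_finite_graph
begin

lemma nbrs_in_V:
  assumes "y \<in> nbrs E x"
  shows "y \<in> V"
  using edges[of "{x, y}"] assms by (auto simp: nbrs_def doubleton_eq_iff)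

lemma not_in_nbrs_self: "x \<notin> nbrs E x"
  using edges[of "{x}"] by (auto simp: nbrs_def)

text \<open>A crude bound, meant only to provide some admissible \<open>K\<close>. With a = f z - f
  y and b = f y - f x, the square of a - b gives a^2/2 - a b \<ge> - b^2/2, and summing over z
  yields the factor \<open>deg E y\<close>.\<close>

lemma carre_du_champ2_lower_bound:
  assumes "x \<in> V"
  shows "- (real (deg E x) + (\<Sum>y\<in>nbrs E x. real (deg E y))) / 2 * carre_du_champ E f f x
    \<le> carre_du_champ2 E f f x"
proof -
  let ?S = "\<Sum>y\<in>nbrs E x. real (deg E y)"
  have "- ?S * carre_du_champ E f f x = (\<Sum>y\<in>nbrs E x. - (?S * ((f y - f x)\<^sup>2 / 2)))"
    by (simp add: carre_du_champ_diag sum_negf sum_distrib_left sum_divide_distrib)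
  \<comment> \<open>Bounding each \<open>deg E y\<close> by the total \<open>?S\<close> makes the
    constant independent of y.\<close>
  also have "\<dots> \<le> (\<Sum>y\<in>nbrs E x. - (real (deg E y) * ((f y - f x)\<^sup>2 / 2)))"
  proof (rule sum_mono)
    fix y assume y: "y \<in> nbrs E x"
    have "real (deg E y) \<le> ?S"
      using y finite_nbrs[OF assms] by (intro member_le_sum) auto
    then show "- (?S * ((f y - f x)\<^sup>2 / 2)) \<le> - (real (deg E y) * ((f y - f x)\<^sup>2 / 2))"
      by (intro le_imp_neg_le mult_right_mono) auto
  qed
  also have "\<dots> = (\<Sum>y\<in>nbrs E x. \<Sum>z\<in>nbrs E y. - ((f y - f x)\<^sup>2 / 2))"
    by (simp add: deg_def)
  also have "\<dots> \<le> (\<Sum>y\<in>nbrs E x. \<Sum>z\<in>nbrs E y. (f z - f y)\<^sup>2 / 2 - (f y - f x) * (f z - f y))"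
  proof (intro sum_mono)
    fix y z
    show "- ((f y - f x)\<^sup>2 / 2) \<le> (f z - f y)\<^sup>2 / 2 - (f y - f x) * (f z - f y)"
      using zero_le_power2[of "(f z - f y) - (f y - f x)"]
      unfolding power2_diff[of "f z - f y" "f y - f x"] by argo
  qed
  also have "\<dots> \<le> \<dots> + (laplacian E f x)\<^sup>2"
    by simp
  finally have "(- ?S * carre_du_champ E f f x - real (deg E x) * carre_du_champ E f f x) / 2
      \<le> carre_du_champ2 E f f x"
    unfolding carre_du_champ2_diag by (intro divide_right_mono diff_right_mono) simp_all
  then show ?thesis
    by (simp add: algebra_simps diff_divide_distrib)
qed

text \<open>Lowering the constant \<open>- C\<close> by \<open>2 * real (deg E x) * ?n\<close>
  absorbs the squared Laplacian, by Cauchy-Schwarz.\<close>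

lemma curvature_dimension_exists:
  assumes "x \<in> V" "0 < N"
  shows "\<exists>K. curvature_dimension E x N K"
proof -
  let ?n = "real_of_ereal (1 / N)"
  obtain C where C: "- C * carre_du_champ E f f x \<le> carre_du_champ2 E f f x" for f
    using carre_du_champ2_lower_bound[OF assms(1)] by (metis minus_divide_left)
  have n: "0 \<le> ?n"
    using assms(2) by (intro real_of_ereal_pos) auto
  have "?n * (laplacian E f x)\<^sup>2 + (- C - 2 * real (deg E x) * ?n) * carre_du_champ E f f x
      \<le> carre_du_champ2 E f f x" for f
    using mult_left_mono[OF laplacian_sq_le n, of E f x] C[of f]
    by (simp add: algebra_simps)
  then show ?thesis
    unfolding curvature_dimension_def by blast
qed

lemma curvature_dimension_le:
  assumes "x \<in> V" "1 \<le> deg E x" "curvature_dimension E x N K"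
  shows "K \<le> curvature_bound0 E x - 2 * real (deg E x) * real_of_ereal (1 / N)"
proof -
  \<comment> \<open>On the vertices that enter the operators at \<open>x\<close>, this is the
    distance from \<open>x\<close>, at most 2 there.\<close>
  define f :: "'a \<Rightarrow> real" where "f z = (if z = x then 0 else if z \<in> nbrs E x then 1 else 2)" for z
  let ?d = "real (deg E x)"
  have fx: "f x = 0" by (simp add: f_def)
  have f1: "f y = 1" if "y \<in> nbrs E x" for y
    using that not_in_nbrs_self by (auto simp: f_def)
  have L: "laplacian E f x = ?d"
    by (simp add: laplacian_def deg_def fx f1)
  have G: "carre_du_champ E f f x = ?d / 2"
    by (simp add: carre_du_champ_diag deg_def fx f1)
  have inner: "(\<Sum>z\<in>nbrs E y. (f z - f y)\<^sup>2 / 2 - (f y - f x) * (f z - f y))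
      = 3 / 2 - real (out_deg E x y) / 2" if y: "y \<in> nbrs E x" for y
  proof -
    have fin: "finite (nbrs E y)"
      using finite_nbrs nbrs_in_V y by blast
    have x: "x \<in> nbrs E y"
      using y by (simp add: nbrs_def insert_commute)
    \<comment> \<open>Here f y - f x = 1, so a summand is a^2/2 - a with a = f z - f y: it equals
      3/2 for z = x (a = -1), 0 for z adjacent to \<open>x\<close> (a = 0), and -1/2 at distance 2
      (a = 1).\<close>
    have "(\<Sum>z\<in>nbrs E y. (f z - f y)\<^sup>2 / 2 - (f y - f x) * (f z - f y))
      = (\<Sum>z\<in>nbrs E y. (if z = x then 3 / 2 else 0) - (if graph_dist E x z = 2 then 1 / 2 else 0))"
      using y by (intro sum.cong) (auto simp: graph_dist_eq_2_iff f_def not_in_nbrs_self power2_eq_square)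
    also have "\<dots> = 3 / 2 - (\<Sum>z\<in>{z\<in>nbrs E y. graph_dist E x z = 2}. 1 / 2)"
      using fin x by (simp only: sum_subtractf sum.delta sum.inter_filter if_True)
    finally show ?thesis
      by (simp add: out_deg_def)
  qed
  have "(\<Sum>y\<in>nbrs E x. \<Sum>z\<in>nbrs E y. (f z - f y)\<^sup>2 / 2 - (f y - f x) * (f z - f y))
      = (\<Sum>y\<in>nbrs E x. 3 / 2 - real (out_deg E x y) / 2)"
    by (intro sum.cong inner refl)
  also have "\<dots> = 3 * ?d / 2 - (\<Sum>y\<in>nbrs E x. real (out_deg E x y)) / 2"
    by (simp add: sum_subtractf deg_def sum_divide_distrib)
  finally have outer: "(\<Sum>y\<in>nbrs E x. \<Sum>z\<in>nbrs E y.
      (f z - f y)\<^sup>2 / 2 - (f y - f x) * (f z - f y))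
      = 3 * ?d / 2 - (\<Sum>y\<in>nbrs E x. real (out_deg E x y)) / 2" .
  have "real_of_ereal (1 / N) * ?d\<^sup>2 + K * (?d / 2) \<le> carre_du_champ2 E f f x"
    using assms(3) unfolding curvature_dimension_def by (metis L G)
  also have "\<dots> = (3 * ?d / 2 - (\<Sum>y\<in>nbrs E x. real (out_deg E x y)) / 2 + ?d\<^sup>2 / 2) / 2"
    unfolding carre_du_champ2_diag outer L G by (simp add: power2_eq_square)
  also have "\<dots> = curvature_bound0 E x * (?d / 2)"
    using assms(2) by (simp add: curvature_bound0_def av_out_deg_def field_simps power2_eq_square)
  finally have "K * (?d / 2)
      \<le> (curvature_bound0 E x - 2 * ?d * real_of_ereal (1 / N)) * (?d / 2)"
    by (simp add: algebra_simps power2_eq_square)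
  then show ?thesis
    using assms(2) by (simp add: mult_le_cancel_right)
qed

text \<open>The admissible \<open>K\<close> form a nonempty closed set bounded above, so its
  supremum is a greatest element and \<open>GREATEST\<close> in \<open>curvature\<close> denotes
  it.\<close>

lemma curvature_dimension_curvature:
  assumes "x \<in> V" "1 \<le> deg E x" "0 < N"
  shows "curvature_dimension E x N (curvature E x N)"
proof -
  let ?A = "{K. curvature_dimension E x N K}"
  have bdd: "bdd_above ?A"
    using curvature_dimension_le[OF assms(1,2)] by (intro bdd_aboveI) blast
  have "Sup ?A \<in> ?A"
    using curvature_dimension_exists[OF assms(1,3)] bdd closed_curvature_dimension
    by (intro closed_contains_Sup) auto
  moreover have "K \<le> Sup ?A" if "curvature_dimension E x N K" for K
    using that bdd by (intro cSup_upper) auto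
  ultimately show ?thesis
    unfolding curvature_def by (metis GreatestI2_order mem_Collect_eq)
qed

text \<open>The bound dominates every admissible \<open>K\<close>, so it is the greatest one as soon
  as it is admissible; conversely the curvature is itself admissible.\<close>

lemma curvature_sharp_iff:
  assumes "x \<in> V" "1 \<le> deg E x" "0 < N"
  shows "curvature_sharp E x N \<longleftrightarrow>
    curvature_dimension E x N (curvature_bound0 E x - 2 * real (deg E x) * real_of_ereal (1 / N))"
proof
  assume "curvature_sharp E x N"
  then show "curvature_dimension E x N
      (curvature_bound0 E x - 2 * real (deg E x) * real_of_ereal (1 / N))"
    using curvature_dimension_curvature[OF assms] by (simp add: curvature_sharp_def)
next
  assume "curvature_dimension E x N
      (curvature_bound0 E x - 2 * real (deg E x) * real_of_ereal (1 / N))"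
  then show "curvature_sharp E x N"
    unfolding curvature_sharp_def curvature_def
    by (rule Greatest_equality) (rule curvature_dimension_le[OF assms(1,2)])
qed

end

text \<open>For finite values this is antitonicity of the reciprocal on positive reals; an infinite
  \<open>N\<close> gives 0 on the left, and an infinite \<open>N'\<close> forces \<open>N\<close> to
  be infinite.\<close>

lemma real_of_ereal_inverse_antimono:
  fixes N N' :: ereal
  assumes "0 < N'" "N' \<le> N"
  shows "real_of_ereal (1 / N) \<le> real_of_ereal (1 / N')"
  using assms by (cases N; cases N') (auto simp: divide_ereal_def le_imp_inverse_le)

theorem proposition4p6:
  fixes V :: "'a set" and E :: "'a set set" and x :: 'a and N N' :: ereal
  assumes "locally_finite_graph V E"
    and "x \<in> V"
    and "deg E x \<ge> 1"
    and "0 < N"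
    and "curvature_sharp E x N"
    and "0 < N'"
    and "N' \<le> N"
  shows "curvature_sharp E x N'"
proof -
  interpret locally_finite_graph V E by fact
  show ?thesis
    using assms(5) real_of_ereal_inverse_antimono[OF assms(6,7)]
    unfolding curvature_sharp_iff[OF assms(2,3,4)] curvature_sharp_iff[OF assms(2,3,6)]
    by (rule curvature_dimension_mono_dim)
qed

end
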